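(* Suppose that $X$ is a topological space, $Y$ is a second countable metric space with metric $d_Y$, and $f \colon X \to Y$ is a function. Then the following are equivalent: (1) The function $f$ is Baire class one. (2) For all $\epsilon > 0$, there is a cover of $X$ by countably-many closed subsets whose $f$-images have $d_Y$-diameter strictly less than $\epsilon$.
   Context: A subset of a topological space is $F_\sigma$ if it is a union of countably-many closed sets. A function between topological spaces is Baire class one if preimages of open sets are $F_\sigma$. *)

theory Defs
  imports "HOL-Analysis.Analysis"
begin

definition Baire_class_one_map :: "'a topology \<Rightarrow> 'b topology \<Rightarrow> ('a \<Rightarrow> 'b) \<Rightarrow> bool" where
  "Baire_class_one_map X Y f \<longleftrightarrow>
     f \<in> topspace X \<rightarrow> topspace Y \<and>
     (\<forall>U. openin Y U \<longrightarrow> fsigma_in X {x \<in> topspace X. f x \<in> U})"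

text \<open>The diameter takes extended values, so that unbounded sets have diameter \<open>\<infinity>\<close>
  (the real-valued \<^const>\<open>diameter\<close> is a real supremum, which is meaningless on such sets).
  The empty set has diameter \<open>0\<close>.\<close>

definition ediameter :: "('b \<Rightarrow> 'b \<Rightarrow> real) \<Rightarrow> 'b set \<Rightarrow> ennreal" where
  "ediameter d S = (SUP (x, y)\<in>S \<times> S. ennreal (d x y))"

end

theory Submission
  imports Defs
begin

text \<open>Both directions are direct. If \<open>f\<close> is Baire class one, then countably many balls of
  radius \<open>\<epsilon> / 3\<close> cover \<open>Y\<close>, because a second countable space is Lindelof. Their preimages are
  countable unions of closed sets, and each of these closed sets is mapped into a single small ball.
  Conversely, given covers for \<open>\<epsilon> = 1, 1/2, 1/3, \<dots>\<close>, the preimage of an open set \<open>U\<close> is the union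
  of those members of the covers that \<open>f\<close> maps into \<open>U\<close>: some ball around
  each point \<open>f x\<close> of \<open>U\<close> lies in \<open>U\<close>, so every member containing \<open>x\<close> of a sufficiently fine cover
  is mapped into \<open>U\<close>.\<close>

lemma dist_less_if_ediameter_less:
  assumes "ediameter d S < ennreal \<epsilon>" "x \<in> S" "y \<in> S" "d x y \<ge> 0"
  shows "d x y < \<epsilon>"
proof -
  have "ennreal (d x y) \<le> ediameter d S"
    unfolding ediameter_def by (rule SUP_upper2[of "(x, y)"]) (use assms in auto)
  then have "ennreal (d x y) < ennreal \<epsilon>"
    using assms(1) by (rule le_less_trans)
  then show ?thesis
    using assms(4) by (simp add: ennreal_less_iff)
qed

lemma (in Metric_space) ediameter_le_if_subset_mball:
  assumes "S \<subseteq> mball c r"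
  shows "ediameter d S \<le> ennreal (2 * r)"
  unfolding ediameter_def
proof (rule SUP_least, clarify)
  fix x y
  assume "x \<in> S" "y \<in> S"
  then have "x \<in> mball c r" "y \<in> mball c r"
    using assms by auto
  then have "d x y \<le> 2 * r"
    using triangle[of x c y] commute[of x c] by auto
  then show "ennreal (d x y) \<le> ennreal (2 * r)"
    by (rule ennreal_leI)
qed

text \<open>The Lindelof property reduces the cover of the target by all balls of a fixed radius to a
  countable one; this is what keeps the closed pieces of all the preimages together countable.\<close>

lemma (in Metric_space) Baire_class_one_imp_small_closed_cover:
  assumes lin: "Lindelof_space mtopology"
    and f: "Baire_class_one_map X mtopology f"
    and \<epsilon>: "(\<epsilon>::real) > 0"
  shows "\<exists>\<C>. countable \<C> \<and> (\<forall>C\<in>\<C>. closedin X C) \<and> \<Union>\<C> = topspace X \<and>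
    (\<forall>C\<in>\<C>. ediameter d (f ` C) < ennreal \<epsilon>)"
proof -
  have fM: "f x \<in> M" if "x \<in> topspace X" for x
    using f that by (auto simp: Baire_class_one_map_def)
  define \<B> where "\<B> = (\<lambda>c. mball c (\<epsilon> / 3)) ` M"
  have "\<Union>\<B> = topspace mtopology"
    using \<epsilon> by (auto simp: \<B>_def)
  moreover have "openin mtopology B" if "B \<in> \<B>" for B
    using that by (auto simp: \<B>_def)
  ultimately obtain \<V> where \<V>: "countable \<V>" "\<V> \<subseteq> \<B>" "\<Union>\<V> = M"
    using Lindelof_spaceD[OF lin, of \<B>] by auto
  have "\<exists>\<U>. countable \<U> \<and> \<U> \<subseteq> Collect (closedin X) \<and> \<Union>\<U> = {x \<in> topspace X. f x \<in> V}"
    if "V \<in> \<V>" for V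
  proof -
    have "openin mtopology V"
      using that \<V>(2) by (auto simp: \<B>_def)
    then have "fsigma_in X {x \<in> topspace X. f x \<in> V}"
      using f by (simp add: Baire_class_one_map_def)
    then show ?thesis
      by (simp add: fsigma_in_def union_of_def)
  qed
  then obtain \<U> where \<U>: "\<And>V. V \<in> \<V> \<Longrightarrow> countable (\<U> V)"
      "\<And>V. V \<in> \<V> \<Longrightarrow> \<U> V \<subseteq> Collect (closedin X)"
      "\<And>V. V \<in> \<V> \<Longrightarrow> \<Union>(\<U> V) = {x \<in> topspace X. f x \<in> V}"
    by metis
  show ?thesis
  proof (intro exI[of _ "\<Union>V\<in>\<V>. \<U> V"] conjI ballI)
    show "countable (\<Union>V\<in>\<V>. \<U> V)"
      using \<V>(1) \<U>(1) by blast
    show "closedin X C" if "C \<in> (\<Union>V\<in>\<V>. \<U> V)" for C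
      using that \<U>(2) by blast
    have "\<Union>(\<Union>V\<in>\<V>. \<U> V) = (\<Union>V\<in>\<V>. \<Union>(\<U> V))"
      by blast
    also have "\<dots> = (\<Union>V\<in>\<V>. {x \<in> topspace X. f x \<in> V})"
      using \<U>(3) by simp
    also have "\<dots> = topspace X"
      using \<V>(3) fM by blast
    finally show "\<Union>(\<Union>V\<in>\<V>. \<U> V) = topspace X" .
    show "ediameter d (f ` C) < ennreal \<epsilon>" if C: "C \<in> (\<Union>V\<in>\<V>. \<U> V)" for C
    proof -
      obtain V where V: "V \<in> \<V>" "C \<in> \<U> V"
        using C by blast
      then have "f ` C \<subseteq> V"
        using \<U>(3)[OF V(1)] by blast
      moreover obtain c where "V = mball c (\<epsilon> / 3)"
        using V(1) \<V>(2) by (auto simp: \<B>_def)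
      ultimately have "ediameter d (f ` C) \<le> ennreal (2 * (\<epsilon> / 3))"
        by (metis ediameter_le_if_subset_mball)
      \<comment> \<open>Radius \<open>\<epsilon> / 3\<close> rather than \<open>\<epsilon> / 2\<close> keeps the supremum strictly below \<open>\<epsilon>\<close>.\<close>
      also have "\<dots> < ennreal \<epsilon>"
        using \<epsilon> by (intro ennreal_lessI) auto
      finally show ?thesis .
    qed
  qed
qed

text \<open>The covers for \<open>\<epsilon> = 1 / (n + 1)\<close> together form one countable family of closed sets, and every
  preimage of an open set is a union of members of this family.\<close>

lemma (in Metric_space) small_closed_covers_imp_Baire_class_one:
  assumes f: "f \<in> topspace X \<rightarrow> M"
    and cov: "\<And>\<epsilon>::real. \<epsilon> > 0 \<Longrightarrow>
      \<exists>\<C>. countable \<C> \<and> (\<forall>C\<in>\<C>. closedin X C) \<and> \<Union>\<C> = topspace X \<and>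
        (\<forall>C\<in>\<C>. ediameter d (f ` C) < ennreal \<epsilon>)"
  shows "Baire_class_one_map X mtopology f"
proof -
  have "\<forall>n. \<exists>\<C>. countable \<C> \<and> (\<forall>C\<in>\<C>. closedin X C) \<and> \<Union>\<C> = topspace X \<and>
      (\<forall>C\<in>\<C>. ediameter d (f ` C) < ennreal (1 / real (Suc n)))"
    by (intro allI cov) simp
  from choice[OF this] obtain \<C> where *: "\<forall>n. countable (\<C> n) \<and> (\<forall>C\<in>\<C> n. closedin X C) \<and>
      \<Union>(\<C> n) = topspace X \<and> (\<forall>C\<in>\<C> n. ediameter d (f ` C) < ennreal (1 / real (Suc n)))" ..
  have \<C>: "countable (\<C> n)" "\<Union>(\<C> n) = topspace X"
    "C \<in> \<C> n \<Longrightarrow> closedin X C"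
    "C \<in> \<C> n \<Longrightarrow> ediameter d (f ` C) < ennreal (1 / real (Suc n))" for n C
    using *[THEN spec, of n] by blast+
  have "fsigma_in X {x \<in> topspace X. f x \<in> U}" if U: "openin mtopology U" for U
  proof -
    define \<D> where "\<D> = {C \<in> (\<Union>n. \<C> n). f ` C \<subseteq> U}"
    have "countable (\<Union>n. \<C> n)"
      using \<C>(1) by simp
    then have "countable \<D>"
      by (rule countable_subset[rotated]) (auto simp: \<D>_def)
    moreover have "fsigma_in X C" if "C \<in> \<D>" for C
      using that \<C>(3) by (auto simp: \<D>_def intro: closed_imp_fsigma_in)
    ultimately have "fsigma_in X (\<Union>\<D>)"
      by (simp add: fsigma_in_Union)
    moreover have "\<Union>\<D> = {x \<in> topspace X. f x \<in> U}"
    proof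
      show "\<Union>\<D> \<subseteq> {x \<in> topspace X. f x \<in> U}"
        using \<C>(2) by (auto simp: \<D>_def)
      show "{x \<in> topspace X. f x \<in> U} \<subseteq> \<Union>\<D>"
      proof clarify
        fix x
        assume x: "x \<in> topspace X" "f x \<in> U"
        obtain r where r: "r > 0" "mball (f x) r \<subseteq> U"
          using U x(2) by (auto simp: openin_mtopology)
        obtain n where n: "1 / real (Suc n) < r"
          using r(1) by (rule nat_approx_posE)
        obtain C where C: "C \<in> \<C> n" "x \<in> C"
          using \<C>(2)[of n] x(1) by blast
        have "f ` C \<subseteq> mball (f x) r"
        proof clarify
          fix y
          assume y: "y \<in> C"
          have "y \<in> topspace X"
            using \<C>(2)[of n] C(1) y by blast
          then have "f y \<in> M" "f x \<in> M"
            using f x(1) by auto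
          moreover have "d (f x) (f y) < 1 / real (Suc n)"
            by (rule dist_less_if_ediameter_less[OF \<C>(4)[OF C(1)]]) (use C(2) y in auto)
          ultimately show "f y \<in> mball (f x) r"
            using n by simp
        qed
        then show "x \<in> \<Union>\<D>"
          using r(2) C by (auto simp: \<D>_def)
      qed
    qed
    ultimately show ?thesis
      by simp
  qed
  then show ?thesis
    using f by (simp add: Baire_class_one_map_def)
qed

theorem proposition1p1:
  fixes X :: "'a topology"
    and Y :: "'b set"
    and d :: "'b \<Rightarrow> 'b \<Rightarrow> real"
    and f :: "'a \<Rightarrow> 'b"
  assumes "Metric_space Y d"
    and "second_countable (Metric_space.mtopology Y d)"
    and "f \<in> topspace X \<rightarrow> Y"
  shows "Baire_class_one_map X (Metric_space.mtopology Y d) f \<longleftrightarrow>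
    (\<forall>\<epsilon>::real. \<epsilon> > 0 \<longrightarrow>
      (\<exists>\<C>. countable \<C> \<and> (\<forall>C\<in>\<C>. closedin X C) \<and> \<Union>\<C> = topspace X \<and>
        (\<forall>C\<in>\<C>. ediameter d (f ` C) < ennreal \<epsilon>)))"
    (is "?B \<longleftrightarrow> ?C")
proof -
  interpret Metric_space Y d
    by (fact assms(1))
  show ?thesis
  proof
    assume ?B
    with second_countable_imp_Lindelof_space[OF assms(2)] show ?C
      by (intro allI impI Baire_class_one_imp_small_closed_cover)
  next
    assume C: ?C
    show ?B
      by (rule small_closed_covers_imp_Baire_class_one[OF assms(3)]) (erule C[rule_format])
  qed
qed

end
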